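(* Let $X$ be a separable Fréchet space and let $T:X\to X$ be a continuous linear operator. Then the following are equivalent. (i) $T$ is hypercyclic and every hypercyclic vector of $T$ is an $\mathcal{AP}$-hypercyclic vector for $T$. (ii) There is an $\mathcal{AP}$-hypercyclic vector for $T$. (iii) $T$ is hypercyclic and multiply recurrent. (iv) For each pair of nonempty open sets $U,V\subseteq X$ and each integer $m>0$ there exists $x\in U$ such that $N_T(x,V)$ contains an arithmetic progression of length $m$. (v) The set of $\mathcal{AP}$-hypercyclic vectors for $T$ is residual in $X$.
   Context: $\mathbb{N}$ is the set of natural numbers. For $m\in\mathbb{N}$, the arithmetic progression of length $m+1$, common difference $k\ge 1$ and initial term $a\in\mathbb{N}$ is the set $\{a,a+k,a+2k,\dots,a+mk\}$. $\mathcal{AP}$ is the family of all subsets of $\mathbb{N}$ that contain arbitrarily long (finite) arithmetic progressions. For $x\in X$ and $U\subseteq X$, $N_T(x,U)=\{n\in\mathbb{N}: T^n x\in U\}$. A vector $x$ is hypercyclic for $T$ if its orbit $\{T^n x\}$ is dense; $T$ is hypercyclic if it has a hypercyclic vector. A vector $x$ is $\mathcal{AP}$-hypercyclic for $T$ if $N_T(x,U)\in\mathcal{AP}$ for every nonempty open set $U\subseteq X$. $T$ is multiply recurrent if for every nonempty open set $U$ and every $m\in\mathbb{N}$ there is $k\ge 1$ such that $U\cap T^{-k}(U)\cap\dots\cap T^{-km}(U)\neq\emptyset$. Residual means containing a dense $G_\delta$ set. *)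

theory Defs
  imports "HOL-Analysis.Analysis"
begin

text \<open>
  The scalar type ranges over \<^class>\<open>real_normed_field\<close>. By the Gelfand--Mazur theorem its
  instances are, up to isomorphism, exactly the real and the complex numbers, so real and complex
  Frechet spaces are treated simultaneously.
\<close>

definition seminorm :: "('k::real_normed_field \<Rightarrow> 'a::ab_group_add \<Rightarrow> 'a) \<Rightarrow> ('a \<Rightarrow> real) \<Rightarrow> bool"
  where "seminorm smul p \<longleftrightarrow>
    (\<forall>x. 0 \<le> p x) \<and> (\<forall>x y. p (x + y) \<le> p x + p y) \<and> (\<forall>c x. p (smul c x) = norm c * p x)"

text \<open>
  A Frechet space is a complete space whose topology is generated by a separating sequence of
  seminorms. Such a topology is metrizable by a translation-invariant metric, so it suffices to
  require convergence of sequences that are Cauchy for every seminorm.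
\<close>

locale frechet_space = vector_space smul
  for smul :: "'k::real_normed_field \<Rightarrow> 'a::{ab_group_add, topological_space} \<Rightarrow> 'a" +
  assumes seminorms: "\<exists>p :: nat \<Rightarrow> 'a \<Rightarrow> real.
      (\<forall>n. seminorm smul (p n)) \<and>
      (\<forall>x. (\<forall>n. p n x = 0) \<longrightarrow> x = 0) \<and>
      (\<forall>U. open U \<longleftrightarrow> (\<forall>x\<in>U. \<exists>n. \<exists>e>0. \<forall>y. (\<forall>i\<le>n. p i (y - x) < e) \<longrightarrow> y \<in> U)) \<and>
      (\<forall>s :: nat \<Rightarrow> 'a. (\<forall>n. \<forall>e>0. \<exists>M. \<forall>i\<ge>M. \<forall>j\<ge>M. p n (s i - s j) < e) \<longrightarrow> convergent s)"

text \<open>The length of a progression is its number of terms.\<close>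

definition arith_prog :: "nat \<Rightarrow> nat \<Rightarrow> nat \<Rightarrow> nat set"
  where "arith_prog a k l = {a + j * k | j. j < l}"

definition contains_arith_prog :: "nat set \<Rightarrow> nat \<Rightarrow> bool"
  where "contains_arith_prog A l \<longleftrightarrow> (\<exists>a k. 1 \<le> k \<and> arith_prog a k l \<subseteq> A)"

definition AP_family :: "nat set set"
  where "AP_family = {A. \<forall>l. contains_arith_prog A l}"

definition return_set :: "('a \<Rightarrow> 'a) \<Rightarrow> 'a \<Rightarrow> 'a set \<Rightarrow> nat set"
  where "return_set T x U = {n. (T ^^ n) x \<in> U}"

definition hypercyclic_vector :: "('a::topological_space \<Rightarrow> 'a) \<Rightarrow> 'a \<Rightarrow> bool"
  where "hypercyclic_vector T x \<longleftrightarrow> closure (range (\<lambda>n. (T ^^ n) x)) = UNIV"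

definition hypercyclic :: "('a::topological_space \<Rightarrow> 'a) \<Rightarrow> bool"
  where "hypercyclic T \<longleftrightarrow> (\<exists>x. hypercyclic_vector T x)"

definition AP_hypercyclic_vector :: "('a::topological_space \<Rightarrow> 'a) \<Rightarrow> 'a \<Rightarrow> bool"
  where "AP_hypercyclic_vector T x \<longleftrightarrow>
    (\<forall>U. open U \<and> U \<noteq> {} \<longrightarrow> return_set T x U \<in> AP_family)"

definition multiply_recurrent :: "('a::topological_space \<Rightarrow> 'a) \<Rightarrow> bool"
  where "multiply_recurrent T \<longleftrightarrow>
    (\<forall>U m. open U \<and> U \<noteq> {} \<longrightarrow> (\<exists>k\<ge>1. (\<Inter>j\<le>m. (T ^^ (k * j)) -` U) \<noteq> {}))"

definition residual :: "'a::topological_space set \<Rightarrow> bool"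
  where "residual A \<longleftrightarrow> (\<exists>G. gdelta_in euclidean G \<and> closure G = UNIV \<and> G \<subseteq> A)"

end

theory Submission
  imports Defs
begin

text \<open>
  A progression \<open>a, a + k, \<dots>, a + m k\<close> of return
  times of \<open>x\<close> to \<open>U\<close> says precisely that \<open>T\<^sup>a x\<close> lies in
  \<open>U \<inter> T\<^sup>-\<^sup>k U \<inter> \<dots> \<inter> T\<^sup>-\<^sup>k\<^sup>m U\<close>. So progressions in the
  return sets of one point force multiple recurrence, and conversely, when \<open>T\<close> is multiply
  recurrent, the intersection is a nonempty open set for a suitable \<open>k\<close>, and the orbit of
  \<^emph>\<open>every\<close> hypercyclic vector enters it
  (\<open>hypercyclic_vector_imp_AP_hypercyclic\<close>).

  For the transitivity-like condition, an AP-hypercyclic \<open>x\<close> visits \<open>U\<close> at some time \<open>s\<close>, and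
  passing from \<open>x\<close> to \<open>T\<^sup>s x\<close> shifts return sets down by \<open>s\<close>. A progression with \<open>s\<close> extra
  terms keeps the required length after its first \<open>s\<close> terms are dropped
  (\<open>contains_arith_prog_shift\<close>). Conversely, that condition says that for nonempty open \<open>V\<close> and
  positive \<open>m\<close> the points whose return set to \<open>V\<close> contains a progression of length \<open>m\<close> are
  dense; by continuity they form an open set. It is enough to let \<open>V\<close> range over a countable base,
  so by Baire's theorem the AP-hypercyclic vectors contain a dense \<open>G\<^sub>\<delta>\<close> set
  (\<open>AP_transitive_imp_residual\<close>).

  The complete metric needed for Baire's theorem is built from the seminorms in
  \<open>completely_metrizable\<close>; together with separability it also yields the countable base.
\<close>

section \<open>Separable Frechet spaces are Polish\<close>

text \<open>
  The usual translation-invariant gauge of a countable family of seminorms, in its supremum form: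
  since the \<open>n\<close>-th seminorm is truncated at \<open>1 / Suc n\<close>, smallness of the gauge constrains only
  finitely many of them. With a supremum rather than a weighted series the triangle inequality and
  the comparison of topologies can be checked one seminorm at a time.
\<close>

definition capped_gauge :: "(nat \<Rightarrow> 'a \<Rightarrow> real) \<Rightarrow> 'a \<Rightarrow> real"
  where "capped_gauge p z = (SUP n. min (1 / Suc n) (p n z))"

lemma capped_gauge_le_iff: "capped_gauge p z \<le> r \<longleftrightarrow> (\<forall>n. min (1 / Suc n) (p n z) \<le> r)"
proof -
  have "bdd_above (range (\<lambda>n. min (1 / real (Suc n)) (p n z)))"
  proof (rule bdd_aboveI)
    fix y assume "y \<in> range (\<lambda>n. min (1 / real (Suc n)) (p n z))"
    then obtain n where n: "y = min (1 / real (Suc n)) (p n z)" by auto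
    have "1 / real (Suc n) \<le> 1" by simp
    then show "y \<le> 1" using n by linarith
  qed
  then show ?thesis
    unfolding capped_gauge_def by (subst cSUP_le_iff) auto
qed

lemma capped_gauge_upper: "min (1 / Suc n) (p n z) \<le> capped_gauge p z"
  by (rule capped_gauge_le_iff[THEN iffD1, rule_format]) (rule order_refl)

text \<open>
  Below \<open>1 / Suc n\<close> the truncation is not active for the indices up to \<open>n\<close>. With
  \<open>capped_gauge_smallI\<close>, this shows that gauge balls and finite intersections of seminorm balls
  are bases of the same neighbourhoods.
\<close>

lemma capped_gauge_less_imp:
  assumes "capped_gauge p z < min (1 / Suc n) e" and "i \<le> n"
  shows "p i z < e"
proof -
  have "min (1 / Suc i) (p i z) \<le> capped_gauge p z"
    by (rule capped_gauge_upper)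
  moreover have "1 / real (Suc n) \<le> 1 / Suc i"
    using assms(2) by (simp add: frac_le)
  ultimately show ?thesis
    using assms(1) by linarith
qed

lemma capped_gauge_smallI:
  assumes "e > 0"
  obtains n where "\<And>z. (\<forall>i\<le>n. p i z < e / 2) \<Longrightarrow> capped_gauge p z < e"
proof -
  obtain n where n: "1 / real (Suc n) < e / 2"
    using nat_approx_posE[of "e / 2"] assms by auto
  have "capped_gauge p z < e" if z: "\<forall>i\<le>n. p i z < e / 2" for z
  proof -
    have "min (1 / Suc i) (p i z) \<le> e / 2" for i
    proof (cases "i \<le> n")
      case False
      then have "1 / real (Suc i) \<le> 1 / Suc n" by (simp add: frac_le)
      with n show ?thesis by linarith
    qed (use z in \<open>auto simp: min_le_iff_disj less_imp_le\<close>)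
    \<comment> \<open>A supremum of terms below a bound may equal the bound, hence the reserve \<open>e / 2\<close>.\<close>
    then have "capped_gauge p z \<le> e / 2"
      by (subst capped_gauge_le_iff) blast
    with assms show ?thesis by linarith
  qed
  with that show thesis by blast
qed

lemma (in frechet_space) seminorm_minus_commute:
  assumes "seminorm smul p"
  shows "p (x - y) = p (y - x)"
proof -
  have "p (smul (- 1) (y - x)) = norm (- 1 :: 'k) * p (y - x)"
    using assms unfolding seminorm_def by blast
  then show ?thesis by simp
qed

lemma (in frechet_space) seminorm_zero:
  assumes "seminorm smul p"
  shows "p 0 = 0"
proof -
  have "p (smul 0 0) = norm (0 :: 'k) * p 0"
    using assms unfolding seminorm_def by blast
  then show ?thesis by simp
qed

text \<open>
  The gauge of \<open>x - y\<close> is a metric, by separation and the triangle inequality for each seminorm.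
  It induces the given topology, and a sequence that is Cauchy for it is Cauchy for each seminorm,
  so sequential completeness is completeness of the metric.
\<close>

lemma (in frechet_space) completely_metrizable:
  "completely_metrizable_space (euclidean :: 'a topology)"
proof -
  obtain p :: "nat \<Rightarrow> 'a \<Rightarrow> real"
    where semi: "\<forall>n. seminorm smul (p n)"
      and sep: "\<forall>x. (\<forall>n. p n x = 0) \<longrightarrow> x = 0"
      and op: "\<forall>U. open U \<longleftrightarrow> (\<forall>x\<in>U. \<exists>n. \<exists>e>0. \<forall>y. (\<forall>i\<le>n. p i (y - x) < e) \<longrightarrow> y \<in> U)"
      and complete: "\<forall>s :: nat \<Rightarrow> 'a.
        (\<forall>n. \<forall>e>0. \<exists>M. \<forall>i\<ge>M. \<forall>j\<ge>M. p n (s i - s j) < e) \<longrightarrow> convergent s"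
    using seminorms by (elim exE conjE) (rule that)
  note semi = semi[THEN spec] and sep = sep[THEN spec, THEN mp]
    and op = op[THEN spec] and complete = complete[THEN spec, THEN mp]
  define d where "d x y = capped_gauge p (x - y)" for x y
  have term_le: "min (1 / Suc n) (p n (x - y)) \<le> d x y" for n x y
    unfolding d_def by (rule capped_gauge_upper)
  have pos: "0 \<le> p n x" for n x using semi unfolding seminorm_def by blast
  have tri: "p n (x + y) \<le> p n x + p n y" for n x y using semi unfolding seminorm_def by blast
  have d_nonneg: "0 \<le> d x y" for x y
    using term_le[of 0 x y] pos[of 0 "x - y"] by linarith
  have d_commute: "d x y = d y x" for x y
    using seminorm_minus_commute[OF semi, of _ x y] by (simp add: d_def capped_gauge_def)
  interpret M: Metric_space UNIV d
  proof
    fix x y z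
    show "0 \<le> d x y" by (rule d_nonneg)
    show "d x y = d y x" by (rule d_commute)
    show "(d x y = 0) = (x = y)"
    proof
      assume d0: "d x y = 0"
      have "p n (x - y) = 0" for n
      proof -
        have "0 < 1 / real (Suc n)" by simp
        then show ?thesis using term_le[of n x y] d0 pos[of n "x - y"] by linarith
      qed
      then show "x = y" using sep[of "x - y"] by simp
    next
      assume "x = y"
      then have "d x y \<le> 0"
        by (simp add: d_def capped_gauge_le_iff seminorm_zero[OF semi])
      with d_nonneg[of x y] show "d x y = 0" by linarith
    qed
    have "min (1 / Suc n) (p n (x - z)) \<le> d x y + d y z" for n
    proof -
      have "p n (x - z) \<le> p n (x - y) + p n (y - z)"
        using tri[of n "x - y" "y - z"] by simp
      moreover have "0 < 1 / real (Suc n)" by simp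
      ultimately show ?thesis
        using term_le[of n x y] term_le[of n y z] pos[of n "x - y"] pos[of n "y - z"] by linarith
    qed
    then show "d x z \<le> d x y + d y z"
      unfolding d_def[of x z] capped_gauge_le_iff by blast
  qed
  have "openin M.mtopology U \<longleftrightarrow> open U" for U
  proof
    assume U: "open U"
    have "\<exists>r>0. M.mball x r \<subseteq> U" if "x \<in> U" for x
    proof -
      obtain n e where "e > 0" and ne: "\<forall>y. (\<forall>i\<le>n. p i (y - x) < e) \<longrightarrow> y \<in> U"
        using bspec[OF op[THEN iffD1, OF U] \<open>x \<in> U\<close>] by (elim exE conjE) (rule that)
      have "M.mball x (min (1 / Suc n) e) \<subseteq> U"
      proof
        fix y assume "y \<in> M.mball x (min (1 / Suc n) e)"
        then have "capped_gauge p (y - x) < min (1 / Suc n) e"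
          by (simp only: M.in_mball d_commute[of x y]) (simp add: d_def)
        then have "\<forall>i\<le>n. p i (y - x) < e"
          using capped_gauge_less_imp[of p "y - x" n e] by simp
        then show "y \<in> U" using ne by simp
      qed
      moreover have "0 < min (1 / Suc n) e" using \<open>e > 0\<close> by simp
      ultimately show ?thesis by blast
    qed
    then show "openin M.mtopology U" by (simp add: M.openin_mtopology)
  next
    assume U: "openin M.mtopology U"
    show "open U"
      proof (rule op[THEN iffD2], rule ballI)
      fix x assume "x \<in> U"
      then obtain r where "r > 0" and r: "M.mball x r \<subseteq> U"
        using U unfolding M.openin_mtopology by blast
      obtain n where n: "\<And>z. (\<forall>i\<le>n. p i z < r / 2) \<Longrightarrow> capped_gauge p z < r"
        using capped_gauge_smallI[OF \<open>r > 0\<close>, where p = p] by blast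
      have "y \<in> U" if "\<forall>i\<le>n. p i (y - x) < r / 2" for y
      proof -
        have "d x y < r" using n[OF that] unfolding d_commute[of x y] by (simp add: d_def)
        then show ?thesis using r by (auto simp: M.in_mball)
      qed
      then show "\<exists>n. \<exists>e>0. \<forall>y. (\<forall>i\<le>n. p i (y - x) < e) \<longrightarrow> y \<in> U"
        using half_gt_zero[OF \<open>r > 0\<close>] by blast
    qed
  qed
  then have top: "M.mtopology = euclidean"
    by (simp add: topology_eq)
  have "M.mcomplete"
    unfolding M.mcomplete_def
  proof (intro allI impI)
    fix s assume s: "M.MCauchy s"
    have "\<exists>N. \<forall>i\<ge>N. \<forall>j\<ge>N. p n (s i - s j) < e" if "e > 0" for n e
    proof -
      have "0 < min (1 / Suc n) e" using that by simp
      then obtain N where "\<And>i j. \<lbrakk>i \<ge> N; j \<ge> N\<rbrakk> \<Longrightarrow> d (s i) (s j) < min (1 / Suc n) e"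
        using s unfolding M.MCauchy_def by meson
      then show ?thesis
        using capped_gauge_less_imp[of p _ n e n] unfolding d_def by blast
    qed
    then have "convergent s" using complete by blast
    then show "\<exists>x. limitin M.mtopology s x sequentially"
      by (simp add: top convergent_def)
  qed
  then show ?thesis
    unfolding completely_metrizable_space_def using M.Metric_space_axioms top by metis
qed

text \<open>
  The balls of radius \<open>1 / Suc n\<close> around the points of a countable dense set form a base: a ball
  of radius less than \<open>r / 2\<close> that contains \<open>x\<close> lies in the ball of radius \<open>r\<close> around \<open>x\<close>.
\<close>

lemma separable_metrizable_imp_second_countable:
  assumes "metrizable_space X" and "separable_space X"
  shows "second_countable X"
proof -
  obtain M d where M: "Metric_space M d" and X: "X = Metric_space.mtopology M d"
    using assms(1) unfolding metrizable_space_def by blast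
  interpret Metric_space M d by (rule M)
  obtain C where C: "countable C" "C \<subseteq> M" "mtopology closure_of C = M"
    using assms(2) unfolding separable_space_def X by auto
  define B where "B = (\<lambda>(c, n). mball c (1 / Suc n)) ` (C \<times> (UNIV :: nat set))"
  have "\<exists>V\<in>B. x \<in> V \<and> V \<subseteq> U" if U: "openin mtopology U" "x \<in> U" for U x
  proof -
    obtain r where "r > 0" and r: "mball x r \<subseteq> U"
      using U unfolding openin_mtopology by blast
    obtain n where n: "1 / real (Suc n) < r / 2"
      using nat_approx_posE[of "r / 2"] \<open>r > 0\<close> by auto
    have "x \<in> M" using U openin_mtopology by blast
    then have "x \<in> mtopology closure_of C" using C by simp
    then obtain c where c: "c \<in> C" "c \<in> mball x (1 / Suc n)"
      unfolding metric_closure_of by (auto dest!: spec[of _ "1 / real (Suc n)"])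
    have "mball c (1 / Suc n) \<subseteq> mball x r"
    proof
      fix y assume y: "y \<in> mball c (1 / Suc n)"
      then have "d x y \<le> d x c + d c y" using \<open>x \<in> M\<close> triangle by auto
      then show "y \<in> mball x r" using c y n \<open>x \<in> M\<close> by auto
    qed
    moreover have "x \<in> mball c (1 / Suc n)" using c \<open>x \<in> M\<close> by (auto simp: commute)
    moreover have "mball c (1 / Suc n) \<in> B" using c by (auto simp: B_def)
    ultimately show ?thesis using r by blast
  qed
  moreover have "countable B" using C by (simp add: B_def)
  moreover have "\<forall>V\<in>B. openin mtopology V" by (auto simp: B_def)
  ultimately show ?thesis unfolding second_countable_def X by blast
qed

section \<open>Progressions in return sets\<close>

lemma contains_arith_prog_iff:
  "contains_arith_prog A l \<longleftrightarrow> (\<exists>a k. 1 \<le> k \<and> (\<forall>j<l. a + j * k \<in> A))"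
  unfolding contains_arith_prog_def arith_prog_def by blast

text \<open>
  A progression with \<open>s + l\<close> terms and common difference at least \<open>1\<close> has reached \<open>s\<close> by its
  term of index \<open>s\<close>, so from there on \<open>s\<close> can be subtracted within the natural numbers.
\<close>

lemma contains_arith_prog_shift:
  assumes "contains_arith_prog A (s + l)"
  shows "contains_arith_prog {n. n + s \<in> A} l"
proof -
  obtain a k where k: "1 \<le> k" and A: "\<And>j. j < s + l \<Longrightarrow> a + j * k \<in> A"
    using assms unfolding contains_arith_prog_iff by blast
  \<comment> \<open>The shifted progression starts at \<open>a + s k - s\<close>, written without truncated subtraction of \<open>s\<close>.\<close>
  have "(a + s * (k - 1)) + j * k + s \<in> A" if "j < l" for j
  proof -
    have "s * (k - 1) + s = s * k" using k by (cases k) auto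
    then have "(a + s * (k - 1)) + j * k + s = a + (s + j) * k" by (simp add: algebra_simps)
    moreover have "a + (s + j) * k \<in> A" using A[of "s + j"] that by simp
    ultimately show ?thesis by (simp only:)
  qed
  with k show ?thesis unfolding contains_arith_prog_iff by blast
qed

lemma return_set_funpow: "return_set T ((T ^^ s) x) V = {n. n + s \<in> return_set T x V}"
  by (simp add: return_set_def funpow_add)

lemma open_vimage_funpow:
  fixes T :: "'a::topological_space \<Rightarrow> 'a"
  assumes "continuous_on UNIV T" and "open U"
  shows "open ((T ^^ n) -` U)"
proof (induction n)
  case (Suc n)
  then have "open (T -` ((T ^^ n) -` U))"
    using assms(1) by (simp add: continuous_on_open_vimage)
  then show ?case by (simp only: funpow_Suc_right vimage_comp)
qed (use assms in simp)

lemma open_contains_arith_prog_return: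
  fixes T :: "'a::topological_space \<Rightarrow> 'a"
  assumes "continuous_on UNIV T" and "open V"
  shows "open {x. contains_arith_prog (return_set T x V) l}"
proof -
  have "{x. contains_arith_prog (return_set T x V) l}
      = (\<Union>a. \<Union>k\<in>{1..}. \<Inter>j\<in>{..<l}. (T ^^ (a + j * k)) -` V)"
    by (auto simp: contains_arith_prog_iff return_set_def)
  then show ?thesis
    by (simp only:) (intro open_UN ballI open_INT finite_lessThan open_vimage_funpow assms)
qed

lemma dense_iff_meets_open:
  fixes S :: "'a::topological_space set"
  shows "closure S = UNIV \<longleftrightarrow> (\<forall>U. open U \<and> U \<noteq> {} \<longrightarrow> S \<inter> U \<noteq> {})"
  using dense_intersects_open[of euclidean S] by simp

lemma hypercyclic_vector_iff:
  "hypercyclic_vector T x \<longleftrightarrow> (\<forall>U. open U \<and> U \<noteq> {} \<longrightarrow> (\<exists>n. (T ^^ n) x \<in> U))"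
  unfolding hypercyclic_vector_def dense_iff_meets_open by blast

lemma hypercyclic_vectorE:
  assumes "hypercyclic_vector T x" and "open U" and "U \<noteq> {}"
  obtains n where "(T ^^ n) x \<in> U"
  using assms unfolding hypercyclic_vector_iff by blast

section \<open>Orbits that meet every open set along progressions\<close>

lemma AP_hypercyclic_vectorD:
  assumes "AP_hypercyclic_vector T x" and "open U" and "U \<noteq> {}"
  shows "contains_arith_prog (return_set T x U) l"
  using assms unfolding AP_hypercyclic_vector_def AP_family_def by blast

lemma AP_hypercyclic_imp_hypercyclic_vector:
  assumes "AP_hypercyclic_vector T x"
  shows "hypercyclic_vector T x"
  unfolding hypercyclic_vector_iff
proof (intro allI impI)
  fix U :: "'a set" assume "open U \<and> U \<noteq> {}"
  then have "contains_arith_prog (return_set T x U) 1"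
    using AP_hypercyclic_vectorD[OF assms] by blast
  then show "\<exists>n. (T ^^ n) x \<in> U"
    by (auto simp: contains_arith_prog_iff return_set_def)
qed

text \<open>
  If \<open>a\<close> is the first term of a progression of return times to \<open>U\<close> with difference \<open>k\<close>, then
  \<open>T\<^sup>a x\<close> is a point of \<open>U\<close> that returns to \<open>U\<close> at the multiples of \<open>k\<close>.
\<close>

lemma AP_hypercyclic_imp_multiply_recurrent:
  assumes "AP_hypercyclic_vector T x"
  shows "multiply_recurrent T"
  unfolding multiply_recurrent_def
proof (intro allI impI)
  fix U :: "'a set" and m :: nat assume "open U \<and> U \<noteq> {}"
  then have "contains_arith_prog (return_set T x U) (Suc m)"
    using AP_hypercyclic_vectorD[OF assms] by blast
  then obtain a k where k: "1 \<le> k" and ap: "\<And>j. j \<le> m \<Longrightarrow> (T ^^ (a + j * k)) x \<in> U"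
    unfolding contains_arith_prog_iff return_set_def by (metis le_imp_less_Suc mem_Collect_eq)
  have "(T ^^ (k * j)) ((T ^^ a) x) = (T ^^ (a + j * k)) x" for j
    by (metis add.commute comp_apply funpow_add mult.commute)
  then have "(T ^^ a) x \<in> (\<Inter>j\<le>m. (T ^^ (k * j)) -` U)" using ap by simp
  then show "\<exists>k\<ge>1. (\<Inter>j\<le>m. (T ^^ (k * j)) -` U) \<noteq> {}" using k by blast
qed

text \<open>
  Multiple recurrence provides, for some \<open>k\<close>, a nonempty open set of points that return to \<open>U\<close> at
  the first multiples of \<open>k\<close>. A dense orbit enters this set at some time \<open>a\<close>, which then starts a
  progression of return times.
\<close>

lemma hypercyclic_vector_imp_AP_hypercyclic:
  fixes T :: "'a::topological_space \<Rightarrow> 'a"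
  assumes cont: "continuous_on UNIV T" and mr: "multiply_recurrent T"
    and hc: "hypercyclic_vector T x"
  shows "AP_hypercyclic_vector T x"
  unfolding AP_hypercyclic_vector_def AP_family_def
proof (intro allI impI CollectI)
  fix U :: "'a set" and l :: nat assume U: "open U \<and> U \<noteq> {}"
  then obtain k where k: "k \<ge> 1" and ne: "(\<Inter>j\<le>l. (T ^^ (k * j)) -` U) \<noteq> {}"
    using mr unfolding multiply_recurrent_def by blast
  have "open (\<Inter>j\<le>l. (T ^^ (k * j)) -` U)"
    using U by (intro open_INT finite_atMost ballI open_vimage_funpow cont) simp
  then obtain a where a: "(T ^^ a) x \<in> (\<Inter>j\<le>l. (T ^^ (k * j)) -` U)"
    by (rule hypercyclic_vectorE[OF hc _ ne])
  have "(T ^^ (a + j * k)) x = (T ^^ (k * j)) ((T ^^ a) x)" for j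
    by (metis add.commute comp_apply funpow_add mult.commute)
  then have "\<forall>j<l. a + j * k \<in> return_set T x U" using a by (simp add: return_set_def)
  then show "contains_arith_prog (return_set T x U) l"
    using k unfolding contains_arith_prog_iff by blast
qed

text \<open>
  The witness is a point of the orbit of \<open>x\<close> in \<open>U\<close>: replacing \<open>x\<close> by a later point of its
  orbit only removes an initial part of each return set.
\<close>

lemma AP_hypercyclic_imp_AP_transitive:
  assumes x: "AP_hypercyclic_vector T x"
    and U: "open U" "U \<noteq> {}" and V: "open V" "V \<noteq> {}"
  shows "\<exists>y\<in>U. contains_arith_prog (return_set T y V) m"
proof -
  obtain s where "(T ^^ s) x \<in> U"
    by (rule hypercyclic_vectorE[OF AP_hypercyclic_imp_hypercyclic_vector[OF x] U])
  moreover have "contains_arith_prog (return_set T ((T ^^ s) x) V) m"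
    unfolding return_set_funpow
    by (rule contains_arith_prog_shift) (rule AP_hypercyclic_vectorD[OF x V])
  ultimately show ?thesis by blast
qed

text \<open>
  Birkhoff's transitivity argument with progressions in place of single visits: the points whose
  return set to a given open set contains a progression of given length form an open dense set, and
  countably many such conditions characterise AP-hypercyclicity.
\<close>

lemma AP_transitive_imp_residual:
  fixes T :: "'a::topological_space \<Rightarrow> 'a"
  assumes Baire: "completely_metrizable_space (euclidean :: 'a topology)"
    and sc: "second_countable (euclidean :: 'a topology)"
    and cont: "continuous_on UNIV T"
    and trans: "\<And>U V m. \<lbrakk>m > 0; open U; U \<noteq> {}; open V; V \<noteq> {}\<rbrakk> \<Longrightarrow>
           \<exists>x\<in>U. contains_arith_prog (return_set T x V) m"
  shows "residual {x. AP_hypercyclic_vector T x}"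
proof -
  obtain B :: "'a set set" where "countable B" and B_open: "\<forall>V\<in>B. open V"
    and base: "\<forall>U x. open U \<and> x \<in> U \<longrightarrow> (\<exists>V\<in>B. x \<in> V \<and> V \<subseteq> U)"
    using sc unfolding second_countable_def open_openin[symmetric] by (elim exE conjE) (rule that)
  define G where "G V m = {x. contains_arith_prog (return_set T x V) m}" for V m
  \<comment> \<open>Density is available for positive lengths only. Longer progressions contain shorter ones.\<close>
  define \<G> where "\<G> = (\<lambda>(V, m). G V (Suc m)) ` ((B - {{}}) \<times> UNIV)"
  have "countable \<G>" using \<open>countable B\<close> by (simp add: \<G>_def)
  have G_open: "open W" if "W \<in> \<G>" for W
    using that B_open open_contains_arith_prog_return[OF cont] by (auto simp: \<G>_def G_def)
  have G_dense: "closure W = UNIV" if W: "W \<in> \<G>" for W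
    unfolding dense_iff_meets_open
  proof (intro allI impI)
    fix U :: "'a set" assume U: "open U \<and> U \<noteq> {}"
    obtain V m where "W = G V (Suc m)" "V \<in> B" "V \<noteq> {}" using W by (auto simp: \<G>_def)
    then show "W \<inter> U \<noteq> {}" using trans[of "Suc m" U V] U B_open by (auto simp: G_def)
  qed
  have "euclidean closure_of \<Inter>\<G> = topspace (euclidean :: 'a topology)"
    by (rule Baire_category) (use Baire \<open>countable \<G>\<close> G_open G_dense in auto)
  then have "closure (\<Inter>\<G>) = UNIV" by simp
  moreover have "gdelta_in euclidean (\<Inter>\<G>)"
    using \<open>countable \<G>\<close> G_open by (auto simp: gdelta_in_alt intersection_of_def)
  moreover have "\<Inter>\<G> \<subseteq> {x. AP_hypercyclic_vector T x}"
  proof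
    fix x assume x: "x \<in> \<Inter>\<G>"
    have "contains_arith_prog (return_set T x U) l" if U: "open U" "U \<noteq> {}" for U l
    proof -
      obtain V where V: "V \<in> B" "V \<noteq> {}" "V \<subseteq> U" using base U by blast
      then have "x \<in> G V (Suc l)" using x by (force simp: \<G>_def)
      then obtain a k where "1 \<le> k" and "\<forall>j<Suc l. a + j * k \<in> return_set T x V"
        by (auto simp: G_def contains_arith_prog_iff)
      moreover have "return_set T x V \<subseteq> return_set T x U" using V by (auto simp: return_set_def)
      ultimately show ?thesis unfolding contains_arith_prog_iff by (meson less_SucI subsetD)
    qed
    then show "x \<in> {x. AP_hypercyclic_vector T x}"
      unfolding AP_hypercyclic_vector_def AP_family_def by blast
  qed
  ultimately show ?thesis unfolding residual_def by blast
qed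

lemma residual_nonempty: "residual A \<Longrightarrow> A \<noteq> {}"
  unfolding residual_def by (metis UNIV_not_empty closure_empty subset_empty)

section \<open>The equivalences\<close>

theorem proposition2p1:
  fixes smul :: "'k::real_normed_field \<Rightarrow> 'a::{ab_group_add, topological_space} \<Rightarrow> 'a"
    and T :: "'a \<Rightarrow> 'a"
  assumes "frechet_space smul"
    and "separable_space (euclidean :: 'a topology)"
    and "Vector_Spaces.linear smul smul T"
    and "continuous_on UNIV T"
  shows
    "((\<exists>x. AP_hypercyclic_vector T x) \<longleftrightarrow>
        hypercyclic T \<and> (\<forall>x. hypercyclic_vector T x \<longrightarrow> AP_hypercyclic_vector T x)) \<and>
     ((\<exists>x. AP_hypercyclic_vector T x) \<longleftrightarrow>
        hypercyclic T \<and> multiply_recurrent T) \<and>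
     ((\<exists>x. AP_hypercyclic_vector T x) \<longleftrightarrow>
        (\<forall>U V. \<forall>m>0. open U \<and> U \<noteq> {} \<and> open V \<and> V \<noteq> {} \<longrightarrow>
           (\<exists>x\<in>U. contains_arith_prog (return_set T x V) m))) \<and>
     ((\<exists>x. AP_hypercyclic_vector T x) \<longleftrightarrow>
        residual {x. AP_hypercyclic_vector T x})"
    (is "(?ap \<longleftrightarrow> ?all) \<and> (?ap \<longleftrightarrow> ?rec) \<and> (?ap \<longleftrightarrow> ?trans) \<and> (?ap \<longleftrightarrow> ?res)")
proof -
  have cm: "completely_metrizable_space (euclidean :: 'a topology)"
    by (rule frechet_space.completely_metrizable) fact
  then have sc: "second_countable (euclidean :: 'a topology)"
    using assms(2) by (intro separable_metrizable_imp_second_countable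
        completely_metrizable_imp_metrizable_space)
  have ap_to_rec: "?rec" if ?ap
    using that AP_hypercyclic_imp_hypercyclic_vector AP_hypercyclic_imp_multiply_recurrent
    unfolding hypercyclic_def by blast
  have rec_to_all: "?all" if ?rec
    using that hypercyclic_vector_imp_AP_hypercyclic[OF assms(4)] by blast
  have all_to_ap: "?ap" if ?all
    using that unfolding hypercyclic_def by blast
  have ap_to_trans: "?trans" if ?ap
    using that AP_hypercyclic_imp_AP_transitive by blast
  have trans_to_res: "?res" if ?trans
    by (rule AP_transitive_imp_residual[OF cm sc assms(4)]) (use that in blast)
  have res_to_ap: "?ap" if ?res
    using residual_nonempty[OF that] by blast
  show ?thesis using ap_to_rec rec_to_all all_to_ap ap_to_trans trans_to_res res_to_ap by argo
qed

end
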